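(* Let $0\le m\le n$ be integers and let $K_m(x,y)$ be the multivariable Christoffel--Darboux kernel associated with the given linear functional, written as $K_m(z)=K_m(z_1,\dots,z_{2m})$ with $(z_1,\dots,z_{2m})=(x_1,\dots,x_m,y_1,\dots,y_m)$. Then, as an identity of rational functions in $z_1,\dots,z_{2m}$, $$K_m(z)=\frac{1}{\prod_{i=1}^m\langle p_{n-i},p_{n-i}\rangle}\,\frac{\det_{1\le i,j\le 2m}\left(p_{n-m+j-1}(z_i)\right)}{\Delta(z)}.$$
   Context: Scalars are complex. Let $f\mapsto\int f(x)\,d\mu(x)$ be a linear functional on polynomials in one variable. For $n\ge1$ let $V_n$ be the space of one-variable polynomials of degree at most $n-1$, and assume that the bilinear pairing $\langle f,g\rangle=\int f(x)g(x)\,d\mu(x)$ is non-degenerate on each $V_n$. Let $(p_k)_{k\ge0}$ be the corresponding monic orthogonal polynomials ($\deg p_k=k$). Let $K(x,y)=\sum_{k=0}^{n-1}\frac{p_k(x)p_k(y)}{\langle p_k,p_k\rangle}$ (depending on $n$). For any tuple of variables $x=(x_1,\dots,x_N)$ put $\Delta(x)=\prod_{1\le i<j\le N}(x_j-x_i)$. Let $V_n^m$ ($0\le m\le n$) be the space of antisymmetric polynomials in $x_1,\dots,x_m$ of degree at most $n-1$ in each $x_i$. Write $\int f(x)\,d\mu_m(x)=\frac1{m!}\int f(x_1,\dots,x_m)\,d\mu(x_1)\cdots d\mu(x_m)$, where the functional is applied in each variable separately. The kernel $K_m(x,y)$, $x=(x_1,\dots,x_m)$, $y=(y_1,\dots,y_m)$,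 is defined by requiring that $\Delta(x)\Delta(y)K_m(x,y)$ be the reproducing kernel of $V_n^m$, i.e. the unique element of $V_n^m\otimes V_n^m$ such that $f(x)=\int f(y)\Delta(x)\Delta(y)K_m(x,y)\,d\mu_m(y)$ for all $f\in V_n^m$. Equivalently, $K_m(x,y)=\frac{\det_{1\le i,j\le m}(K(x_i,y_j))}{\Delta(x)\Delta(y)}$, which is a polynomial. Empty products and determinants equal $1$. *)

theory Defs
  imports
    Complex_Main
    "HOL-Library.Poly_Mapping"
    "HOL-Combinatorics.Permutations"
    "HOL-Computational_Algebra.Polynomial"
    "HOL-Computational_Algebra.Polynomial_Factorial"
    "Jordan_Normal_Form.Determinant"
begin

section \<open>The functional and its orthogonal polynomials\<close>

definition pairing :: "(complex poly \<Rightarrow> complex) \<Rightarrow> complex poly \<Rightarrow> complex poly \<Rightarrow> complex" where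
  "pairing L f g = L (f * g)"

definition polys_upto :: "nat \<Rightarrow> complex poly set" where
  "polys_upto n = {f. degree f \<le> n - 1}"

text \<open>The pairing is symmetric, so a one-sided condition suffices.\<close>

definition nondegenerate_on :: "(complex poly \<Rightarrow> complex) \<Rightarrow> complex poly set \<Rightarrow> bool" where
  "nondegenerate_on L V \<longleftrightarrow> (\<forall>f\<in>V. (\<forall>g\<in>V. pairing L f g = 0) \<longrightarrow> f = 0)"

definition monic_orthogonal :: "(complex poly \<Rightarrow> complex) \<Rightarrow> (nat \<Rightarrow> complex poly) \<Rightarrow> bool" where
  "monic_orthogonal L p \<longleftrightarrow>
     (\<forall>k. degree (p k) = k \<and> lead_coeff (p k) = 1) \<and>
     (\<forall>j k. j \<noteq> k \<longrightarrow> pairing L (p j) (p k) = 0)"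

section \<open>Polynomials in several variables\<close>

text \<open>
  Polynomials in the variables \<open>X 0, X 1, \<dots>\<close>: finitely supported maps from exponent vectors
  to coefficients, multiplied by convolution. This type is an integral domain, so its fraction
  field is the field of rational functions.
\<close>

type_synonym mpoly = "(nat \<Rightarrow>\<^sub>0 nat) \<Rightarrow>\<^sub>0 complex"

definition Const :: "complex \<Rightarrow> mpoly" where
  "Const c = Poly_Mapping.single 0 c"

definition X :: "nat \<Rightarrow> mpoly" where
  "X i = Poly_Mapping.single (Poly_Mapping.single i 1) 1"

definition univ_at :: "complex poly \<Rightarrow> mpoly \<Rightarrow> mpoly" where
  "univ_at f t = poly (map_poly Const f) t"

text \<open>\<open>msubst \<theta> f\<close> is \<open>f (\<theta> 0, \<theta> 1, \<dots>)\<close>.\<close>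

definition msubst :: "(nat \<Rightarrow> mpoly) \<Rightarrow> mpoly \<Rightarrow> mpoly" where
  "msubst \<theta> f =
     (\<Sum>a\<in>Poly_Mapping.keys f. Const (Poly_Mapping.lookup f a) *
        (\<Prod>i\<in>Poly_Mapping.keys a. \<theta> i ^ Poly_Mapping.lookup a i))"

definition Delta :: "nat \<Rightarrow> (nat \<Rightarrow> 'a::comm_ring_1) \<Rightarrow> 'a" where
  "Delta N x = (\<Prod>j<N. \<Prod>i<j. x j - x i)"

text \<open>
  Application of the functional in the variable \<open>X i\<close>, the other variables being parameters:
  in each monomial the factor \<open>X i ^ k\<close> is replaced by the scalar \<open>L (x ^ k)\<close>.
\<close>

definition integrate_var :: "(complex poly \<Rightarrow> complex) \<Rightarrow> nat \<Rightarrow> mpoly \<Rightarrow> mpoly" where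
  "integrate_var L i f =
     (\<Sum>a\<in>Poly_Mapping.keys f.
        Poly_Mapping.single (Poly_Mapping.update i 0 a)
          (Poly_Mapping.lookup f a * L (monom 1 (Poly_Mapping.lookup a i))))"

text \<open>The integral \<open>d\<mu>\<^sub>m\<close> over the \<open>m\<close> variables \<open>X s, \<dots>, X (s + m - 1)\<close>.\<close>

definition integrate_vars :: "(complex poly \<Rightarrow> complex) \<Rightarrow> nat \<Rightarrow> nat \<Rightarrow> mpoly \<Rightarrow> mpoly" where
  "integrate_vars L s m f = Const (1 / fact m) * foldr (integrate_var L) [s..<s + m] f"

section \<open>The multivariable Christoffel--Darboux kernel\<close>

text \<open>
  The space \<open>V\<^sub>n\<^sup>m\<close>, in the variables \<open>X 0, \<dots>, X (m - 1)\<close>. The degree bound is written \<open>< n\<close>;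
  for \<open>m = 0\<close> the space consists of the constants.
\<close>

definition antisym_space :: "nat \<Rightarrow> nat \<Rightarrow> mpoly set" where
  "antisym_space n m =
     {f. (\<forall>a\<in>Poly_Mapping.keys f. Poly_Mapping.keys a \<subseteq> {..<m} \<and>
            (\<forall>i<m. Poly_Mapping.lookup a i < n)) \<and>
         (\<forall>\<sigma>. \<sigma> permutes {..<m} \<longrightarrow> msubst (\<lambda>i. X (\<sigma> i)) f = of_int (sign \<sigma>) * f)}"

text \<open>
  In all that follows \<open>x\<^sub>i\<close> is \<open>X (i - 1)\<close> and \<open>y\<^sub>i\<close> is \<open>X (m + i - 1)\<close>, so that
  \<open>z = (X 0, \<dots>, X (2 * m - 1))\<close>. An element of \<open>V\<^sub>n\<^sup>m \<otimes> V\<^sub>n\<^sup>m\<close> is a polynomial in \<open>x\<close> and \<open>y\<close>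
  that is a finite sum of products \<open>f(x) g(y)\<close>.
\<close>

definition to_y :: "nat \<Rightarrow> mpoly \<Rightarrow> mpoly" where
  "to_y m f = msubst (\<lambda>i. X (m + i)) f"

definition antisym_tensor :: "nat \<Rightarrow> nat \<Rightarrow> mpoly set" where
  "antisym_tensor n m =
     {(\<Sum>k<N. f k * to_y m (g k)) | (N::nat) f g.
        \<forall>k<N. f k \<in> antisym_space n m \<and> g k \<in> antisym_space n m}"

definition is_reproducing_kernel ::
    "(complex poly \<Rightarrow> complex) \<Rightarrow> nat \<Rightarrow> nat \<Rightarrow> mpoly \<Rightarrow> bool" where
  "is_reproducing_kernel L n m R \<longleftrightarrow>
     R \<in> antisym_tensor n m \<and>
     (\<forall>f\<in>antisym_space n m. f = integrate_vars L m m (to_y m f * R))"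

definition cd_kernel :: "(complex poly \<Rightarrow> complex) \<Rightarrow> nat \<Rightarrow> nat \<Rightarrow> mpoly" where
  "cd_kernel L n m =
     (THE K. is_reproducing_kernel L n m (Delta m X * Delta m (\<lambda>i. X (m + i)) * K))"

end

theory Submission
  imports Defs
begin

text \<open>
  Write \<open>x\<close> for the first \<open>m\<close> and \<open>y\<close> for the last \<open>m\<close> of the variables \<open>z\<close>, and let \<open>h k\<close> be
  the squared norm of \<open>p k\<close>. The proof compares both sides with the determinant \<open>D\<close> of the
  matrix \<open>K(x j, y i)\<close>.

  The kernel. Expanding \<open>D\<close> over permutations and integrating against \<open>f(y)\<close> one variable at a
  time, the one-variable reproducing property shows that \<open>D\<close> reproduces antisymmetric
  polynomials (\<open>CD_det_reproduces\<close>). A Cauchy--Binet expansion writes \<open>D\<close> as a sum of products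
  of alternants \<open>det (p (k i) (x j))\<close> and \<open>det (p (k i) (y j))\<close>. This gives three facts: \<open>D\<close> is
  in the tensor square of the space, it is the only reproducing kernel there
  (\<open>reproducing_unique\<close>), and it is divisible by \<open>\<Delta>(x) \<Delta>(y)\<close>, since Newton interpolation
  extracts \<open>\<Delta>\<close> from any alternant (\<open>Delta_factor_alternant\<close>). Hence
  \<open>D = \<Delta>(x) \<Delta>(y) K\<^sub>m(x, y)\<close>.

  The determinant of size \<open>2 m\<close>. The polynomials \<open>K(x j, t) \<Prod>i<m. (t - x i)\<close> lie in the span
  of \<open>p (n - m), \<dots>, p (n + m - 1)\<close> and vanish at all points of \<open>x\<close>. Using them together with
  \<open>p n, \<dots>, p (n + m - 1)\<close> as columns makes the matrix \<open>p (n - m + j) (z i)\<close> block triangular,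
  and after cancelling the nonzero determinant \<open>det (p (n + j) (x i))\<close> one finds
  \<open>det (p (n - m + j) (z i)) = (\<Prod>i=1..m. h (n - i)) * \<Prod>(y i - x j) * D\<close>
  (\<open>CD_determinant_identity\<close>, \<open>alternant_p_nonzero\<close>). As \<open>\<Delta>(z) = \<Delta>(x) \<Delta>(y) \<Prod>(y i - x j)\<close>, the
  theorem follows.

  Both determinant identities are statements about univariate orthogonal polynomials with
  coefficients in an integral domain that contains the points of \<open>z\<close>. They are proved in that
  generality and applied to the multivariate polynomial ring.
\<close>

section \<open>Determinants and the Vandermonde product\<close>

lemma det_mat_rows:
  "det (mat m m (\<lambda>(i,j). f i j)) = (\<Sum>\<sigma> | \<sigma> permutes {..<m}. of_int (sign \<sigma>) * (\<Prod>i<m. f i (\<sigma> i)))"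
proof -
  have "(\<Prod>i<m. mat m m (\<lambda>(i,j). f i j) $$ (i, \<sigma> i)) = (\<Prod>i<m. f i (\<sigma> i))"
    if "\<sigma> permutes {..<m}" for \<sigma>
    using permutes_in_image[OF that] by (intro prod.cong) auto
  then show ?thesis
    by (subst det_def'[of _ m]) (auto simp flip: lessThan_atLeast0 intro!: sum.cong)
qed

lemma det_mat_columns:
  "det (mat m m (\<lambda>(i,j). f i j)) = (\<Sum>\<sigma> | \<sigma> permutes {..<m}. of_int (sign \<sigma>) * (\<Prod>j<m. f (\<sigma> j) j))"
proof -
  have "det (mat m m (\<lambda>(i,j). f i j)) = det (transpose_mat (mat m m (\<lambda>(i,j). f j i)))"
    by (intro arg_cong[of _ _ det] eq_matI) auto
  then show ?thesis
    by (simp add: det_transpose[of _ m] det_mat_rows)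
qed

lemma det_permute_columns:
  fixes f :: "nat \<Rightarrow> nat \<Rightarrow> 'a::comm_ring_1"
  assumes \<sigma>: "\<sigma> permutes {..<m}"
  shows "det (mat m m (\<lambda>(i,j). f i (\<sigma> j))) = signof \<sigma> * det (mat m m (\<lambda>(i,j). f i j))"
proof -
  note assms = \<sigma>[unfolded lessThan_atLeast0]
  let ?A = "mat m m (\<lambda>(j,i). f i j)"
  have t: "mat m m (\<lambda>(i,j). f i (\<sigma> j)) = transpose_mat (mat m m (\<lambda>(j,i). ?A $$ (\<sigma> j, i)))"
    using permutes_in_image[OF assms] by (intro eq_matI) auto
  have "mat m m (\<lambda>(i,j). f i j) = transpose_mat ?A" by (intro eq_matI) auto
  moreover have "det (transpose_mat ?A) = det ?A" by (rule det_transpose[of _ m]) simp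
  ultimately show ?thesis
    unfolding t using det_permute_rows[of ?A m, OF _ assms] by (subst det_transpose[of _ m]) simp_all
qed

lemma Delta_split:
  "Delta (m + k) x = Delta m x * Delta k (\<lambda>i. x (m + i)) * (\<Prod>b<k. \<Prod>i<m. x (m + b) - x i)"
proof -
  have split: "(\<Prod>i<m + b. f i) = (\<Prod>i<m. f i) * (\<Prod>i<b. f (m + i))" for b and f :: "nat \<Rightarrow> 'a"
    by (induction b) (auto simp: mult_ac)
  show ?thesis by (simp add: Delta_def split prod.distrib mult_ac)
qed

text \<open>
  Newton interpolation at the points \<open>x 0, \<dots>, x (m - 1)\<close> factors the matrix of values
  \<open>f i (x j)\<close> into the matrix of divided differences and the matrix of values of the Newton
  polynomials \<open>\<Prod>r<l. (t - x r)\<close>. The latter is triangular with determinant \<open>Delta m x\<close>.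
  Newton interpolation only divides by monic linear polynomials, so the points may be
  indeterminates.
\<close>

lemma Delta_factor_alternant:
  fixes f :: "nat \<Rightarrow> 'a::comm_ring_1 poly" and x :: "nat \<Rightarrow> 'a"
  shows "\<exists>c. det (mat m m (\<lambda>(i,j). poly (f i) (x j))) = Delta m x * c"
proof -
  define N where "N l = (\<Prod>r<l. [:- x r, 1:])" for l :: nat
  have ex: "\<exists>c q. F = (\<Sum>l<k. smult (c l) (N l)) + N k * q" for F :: "'a poly" and k
  proof (induction k)
    case 0
    show ?case by (simp add: N_def)
  next
    case (Suc k)
    then obtain c q where F: "F = (\<Sum>l<k. smult (c l) (N l)) + N k * q" by blast
    have q: "q = [:poly q (x k):] + [:- x k, 1:] * synthetic_div q (x k)"
      using synthetic_div_correct'[of "x k" q] by (simp add: add.commute)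
    have "N k * q = smult (poly q (x k)) (N k) + N (Suc k) * synthetic_div q (x k)"
      by (subst q) (simp add: N_def algebra_simps)
    moreover have "(\<Sum>l<k. smult (c l) (N l)) = (\<Sum>l<k. smult ((c(k := poly q (x k))) l) (N l))"
      by (intro sum.cong) auto
    ultimately have "F = (\<Sum>l<Suc k. smult ((c(k := poly q (x k))) l) (N l)) + N (Suc k) * synthetic_div q (x k)"
      using F by (simp add: add.assoc)
    then show ?case by blast
  qed
  have "\<forall>i. \<exists>c q. f i = (\<Sum>l<m. smult (c l) (N l)) + N m * q" using ex by blast
  then obtain c q where f: "\<And>i. f i = (\<Sum>l<m. smult (c i l) (N l)) + N m * q i" by metis
  have N0: "poly (N l) (x j) = 0" if "j < l" for l j
    using that by (auto simp: N_def poly_prod intro!: prod_zero)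
  let ?A = "mat m m (\<lambda>(i,l). c i l)" and ?B = "mat m m (\<lambda>(l,j). poly (N l) (x j))"
  have "mat m m (\<lambda>(i,j). poly (f i) (x j)) = ?A * ?B"
    by (rule eq_matI) (auto simp: f N0 poly_sum scalar_prod_def lessThan_atLeast0)
  moreover have "det ?B = Delta m x"
  proof -
    have "det ?B = prod_list (diag_mat ?B)"
      by (rule det_upper_triangular[of _ m]) (auto simp: upper_triangular_def N0)
    also have "\<dots> = Delta m x"
      by (simp add: prod_list_diag_prod Delta_def N_def poly_prod lessThan_atLeast0)
    finally show ?thesis .
  qed
  ultimately have "det (mat m m (\<lambda>(i,j). poly (f i) (x j))) = det ?A * Delta m x"
    using det_mult[of ?A m ?B] by simp
  then show ?thesis by (metis mult.commute)
qed

section \<open>Orthogonal polynomials over an integral domain\<close>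

text \<open>
  The scalars are an arbitrary integral domain, because the theory is applied with coefficients
  in the ring of polynomials in \<open>X 0, X 1, \<dots>\<close>: the interpolation nodes are then themselves
  scalars, and a multivariate identity becomes one about univariate polynomials.
\<close>

locale monic_sequence =
  fixes q :: "nat \<Rightarrow> 'a::idom poly"
  assumes degree_q: "degree (q k) = k"
    and monic_q: "lead_coeff (q k) = 1"
begin

lemma coeff_q_self: "coeff (q k) k = 1"
  using monic_q[of k] by (simp add: degree_q)

lemma coeff_q_above: "k < i \<Longrightarrow> coeff (q k) i = 0"
  by (simp add: coeff_eq_0 degree_q)

lemma ex_expansion:
  assumes "\<And>i. i \<ge> N \<Longrightarrow> coeff f i = 0"
  shows "\<exists>c. f = (\<Sum>k<N. smult (c k) (q k))"
  using assms
proof (induction N arbitrary: f)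
  case 0
  then show ?case by (auto intro: poly_eqI)
next
  case (Suc N)
  let ?h = "f - smult (coeff f N) (q N)"
  have "coeff ?h i = 0" if "i \<ge> N" for i
    using that Suc.prems[of i] by (cases "i = N") (auto simp: coeff_q_self coeff_q_above)
  then obtain c where "?h = (\<Sum>k<N. smult (c k) (q k))" using Suc.IH by blast
  moreover have "(\<Sum>k<N. smult (c k) (q k)) = (\<Sum>k<N. smult ((c(N := coeff f N)) k) (q k))"
    by (intro sum.cong) auto
  ultimately have "f - smult (coeff f N) (q N) = (\<Sum>k<N. smult ((c(N := coeff f N)) k) (q k))"
    by (rule trans)
  then have "f = (\<Sum>k<Suc N. smult ((c(N := coeff f N)) k) (q k))"
    unfolding sum.lessThan_Suc diff_eq_eq fun_upd_same .
  then show ?case by (rule exI[of _ "c(N := coeff f N)"])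
qed

end

text \<open>
  The scalar \<open>g k\<close> is the inverse of the squared norm of \<open>q k\<close>. It is a parameter since
  inverses need not exist in the ring.
\<close>

locale orthogonal_polys = monic_sequence q for q :: "nat \<Rightarrow> 'a::idom poly" +
  fixes \<Lambda> :: "'a poly \<Rightarrow> 'a" and g :: "nat \<Rightarrow> 'a"
  assumes L_add: "\<Lambda> (a + b) = \<Lambda> a + \<Lambda> b"
    and L_smult: "\<Lambda> (smult c a) = c * \<Lambda> a"
    and orth: "j \<noteq> k \<Longrightarrow> \<Lambda> (q j * q k) = 0"
    and inverse_sqnorm: "\<Lambda> (q k * q k) * g k = 1"
begin

lemma L_0 [simp]: "\<Lambda> 0 = 0"
  using L_smult[of 0 0] by simp

lemma L_sum: "\<Lambda> (\<Sum>i\<in>I. f i) = (\<Sum>i\<in>I. \<Lambda> (f i))"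
  by (induction I rule: infinite_finite_induct) (auto simp: L_add)

lemma L_sum_q:
  "\<Lambda> ((\<Sum>k\<in>I. smult (c k) (q k)) * q l) = (if finite I \<and> l \<in> I then c l * \<Lambda> (q l * q l) else 0)"
proof (cases "finite I")
  case True
  have "\<Lambda> ((\<Sum>k\<in>I. smult (c k) (q k)) * q l) = (\<Sum>k\<in>I. if l = k then c l * \<Lambda> (q l * q l) else 0)"
    by (auto simp: sum_distrib_right L_sum L_smult orth intro!: sum.cong)
  then show ?thesis using True by simp
qed auto

lemma expansion:
  assumes "\<And>i. i \<ge> N \<Longrightarrow> coeff f i = 0"
  shows "f = (\<Sum>k<N. smult (\<Lambda> (f * q k) * g k) (q k))"
proof -
  obtain c where c: "f = (\<Sum>k<N. smult (c k) (q k))" using ex_expansion[OF assms] by blast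
  have "\<Lambda> (f * q k) * g k = c k" if "k < N" for k
    using that inverse_sqnorm[of k] by (simp add: c L_sum_q mult.assoc)
  then show ?thesis using c by simp
qed

lemma orth_lower:
  assumes "\<And>i. i \<ge> l \<Longrightarrow> coeff f i = 0"
  shows "\<Lambda> (f * q l) = 0"
proof -
  obtain c where f: "f = (\<Sum>k<l. smult (c k) (q k))" using ex_expansion[OF assms] by blast
  show ?thesis unfolding f by (subst L_sum_q) simp
qed

text \<open>
  The Christoffel--Darboux kernel, as a polynomial in its second argument.
\<close>

definition CD :: "nat \<Rightarrow> 'a \<Rightarrow> 'a poly" where
  "CD n x = (\<Sum>k<n. smult (g k * poly (q k) x) (q k))"

lemma coeff_CD: "i \<ge> n \<Longrightarrow> coeff (CD n x) i = 0"
  by (auto simp: CD_def coeff_sum coeff_q_above intro!: sum.neutral)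

lemma CD_q: "\<Lambda> (q l * CD n x) = (if l < n then poly (q l) x else 0)"
proof -
  have "g l * poly (q l) x * \<Lambda> (q l * q l) = poly (q l) x * (\<Lambda> (q l * q l) * g l)"
    by (simp only: mult_ac)
  then show ?thesis
    unfolding mult.commute[of "q l" "CD n x"] unfolding CD_def L_sum_q inverse_sqnorm by simp
qed

lemma CD_reproducing:
  assumes "\<And>i. i \<ge> n \<Longrightarrow> coeff f i = 0"
  shows "\<Lambda> (f * CD n x) = poly f x"
proof -
  obtain c where f: "f = (\<Sum>k<n. smult (c k) (q k))" using ex_expansion[OF assms] by blast
  have "\<Lambda> (f * CD n x) = (\<Sum>k<n. c k * \<Lambda> (q k * CD n x))"
    by (simp add: f sum_distrib_right L_sum L_smult)
  then show ?thesis by (simp add: f poly_sum CD_q)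
qed

section \<open>Two expressions for the determinant of Christoffel--Darboux kernels\<close>

text \<open>
  With \<open>x = (z 0, \<dots>, z (m - 1))\<close> and \<open>y = (z m, \<dots>, z (2 m - 1))\<close>, this is the identity
  between \<open>det (q (n - m + j) (z i))\<close>, divided by the squared norms of
  \<open>q (n - m), \<dots>, q (n - 1)\<close>, and \<open>\<Prod>(y i - x j) * det (K (x j) (y i))\<close>, both multiplied by the
  minor \<open>det (q (n + j) (x i))\<close>.

  Put \<open>P = \<Prod>j<m. (t - x j)\<close>. The polynomials \<open>P(t) K(x j, t)\<close> vanish at every \<open>x i\<close>, and they
  lie in the span of \<open>q (n - m), \<dots>, q (n + m - 1)\<close>: their degree is less than \<open>n + m\<close>, and for
  \<open>k < n - m\<close> the reproducing property gives \<open>\<Lambda> (P q k K(x j, \<cdot>)) = P (x j) q k (x j) = 0\<close>.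
  Hence multiplying the matrix of values \<open>q (n - m + j) (z i)\<close> by the matrix whose columns
  represent \<open>q n, \<dots>, q (n + m - 1)\<close> and these \<open>m\<close> polynomials gives a block triangular matrix
  with diagonal blocks \<open>q (n + j) (x i)\<close> and \<open>P (y i) K (x j, y i)\<close>.

  The determinant of the second factor requires only the coefficients of \<open>P(t) K(x j, t)\<close> on
  \<open>q (n - m + a)\<close> for \<open>a < m\<close>. Since \<open>P q (n - m + a)\<close> vanishes at \<open>x j\<close>, its projection to
  degrees below \<open>n\<close> takes there the opposite of the value of its component on
  \<open>q n, \<dots>, q (n + m - 1)\<close>. That component is unitriangular in \<open>a\<close>, so that the minor
  \<open>det (q (n + j) (x i))\<close> reappears.
\<close>

lemma CD_determinant_identity:
  assumes "m \<le> n"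
  shows "det (mat (2*m) (2*m) (\<lambda>(i,j). poly (q (n - m + j)) (z i))) * (\<Prod>a<m. g (n - m + a))
      * det (mat m m (\<lambda>(i,j). poly (q (n + j)) (z i)))
    = (\<Prod>i<m. \<Prod>j<m. z (m + i) - z j) * det (mat m m (\<lambda>(i,j). poly (CD n (z j)) (z (m + i))))
      * det (mat m m (\<lambda>(i,j). poly (q (n + j)) (z i)))"
proof -
  define P where "P = (\<Prod>j<m. [:- z j, 1:])"
  have P0: "poly P (z j) = 0" if "j < m" for j
    using that by (auto simp: P_def poly_prod)
  have degP: "degree P = m"
    using degree_prod_sum_eq[of "{..<m}" "\<lambda>j. [:- z j, 1:]"] by (simp add: P_def)
  have lcP: "lead_coeff P = 1"
    by (simp add: P_def lead_coeff_prod)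
  define S where "S j = P * CD n (z j)" for j
  define s where "s j k = \<Lambda> (S j * q k) * g k" for j k
  define l where "l a = n - m + a" for a
  define c where "c a b = \<Lambda> (P * q (l a) * q (n + b)) * g (n + b)" for a b
  have degPq: "coeff (P * q k) i = 0" if "i > m + k" for i k
    using that degree_mult_le[of P "q k"] by (intro coeff_eq_0) (simp add: degP degree_q)
  have lcPq: "coeff (P * q k) (m + k) = 1" for k
    using coeff_mult_degree_sum[of P "q k"] lcP coeff_q_self[of k] by (simp add: degP degree_q)
  \<comment> \<open>below degree \<open>n - m\<close> the product \<open>P q k\<close> is still reproduced, and \<open>P\<close> vanishes at \<open>z j\<close>\<close>
  have s_low: "s j k = 0" if "j < m" "k < n - m" for j k
  proof -
    have "\<Lambda> (P * q k * CD n (z j)) = poly (P * q k) (z j)"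
      using that by (intro CD_reproducing degPq) auto
    then show ?thesis using that P0[of j] by (simp add: s_def S_def mult_ac)
  qed
  \<comment> \<open>only the part of \<open>P q (l a)\<close> of degree below \<open>n\<close> is reproduced; as \<open>P (z j) = 0\<close>, its value is minus that of the rest\<close>
  have s_mid: "s j (l a) = - g (l a) * (\<Sum>b<m. c a b * poly (q (n + b)) (z j))"
    if "j < m" "a < m" for j a
  proof -
    define d where "d r = \<Lambda> (P * q (l a) * q r) * g r" for r
    have "P * q (l a) = (\<Sum>r<n + m. smult (d r) (q r))"
      unfolding d_def using that assms by (intro expansion degPq) (auto simp: l_def)
    also have "\<dots> = (\<Sum>r<n. smult (d r) (q r)) + (\<Sum>b<m. smult (d (n + b)) (q (n + b)))"
      by (induction m) (auto simp: add_ac)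
    finally have e: "P * q (l a) = (\<Sum>r<n. smult (d r) (q r)) + (\<Sum>b<m. smult (d (n + b)) (q (n + b)))" .
    have "\<Lambda> ((P * q (l a)) * CD n (z j)) = poly (\<Sum>r<n. smult (d r) (q r)) (z j)"
      unfolding e by (simp add: distrib_right L_add sum_distrib_right L_sum L_smult CD_q poly_sum)
    also have "\<dots> = poly (P * q (l a)) (z j) - (\<Sum>b<m. d (n + b) * poly (q (n + b)) (z j))"
      unfolding e by (simp add: poly_sum)
    also have "\<dots> = - (\<Sum>b<m. c a b * poly (q (n + b)) (z j))"
      using P0[OF \<open>j < m\<close>] by (simp add: c_def d_def)
    finally show ?thesis by (simp add: s_def S_def mult_ac)
  qed
  have S_exp: "S j = (\<Sum>c<m. smult (s j (l c)) (q (l c))) + (\<Sum>c<m. smult (s j (n + c)) (q (n + c)))"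
    if "j < m" for j
  proof -
    have "coeff (S j) i = 0" if "i \<ge> n + m" for i
    proof -
      have "degree (CD n (z j)) \<le> n - 1"
        using coeff_CD by (intro degree_le) auto
      then have "degree (S j) \<le> m + (n - 1)"
        unfolding S_def using degree_mult_le[of P "CD n (z j)"] by (simp add: degP)
      then show ?thesis using that \<open>j < m\<close> assms by (intro coeff_eq_0) auto
    qed
    then have "S j = (\<Sum>k<n + m. smult (s j k) (q k))"
      unfolding s_def by (rule expansion)
    also have "\<dots> = (\<Sum>k<(n - m) + m + m. smult (s j k) (q k))"
      using assms by simp
    also have "\<dots> = (\<Sum>k<n - m. smult (s j k) (q k)) + (\<Sum>c<m. smult (s j (n - m + c)) (q (n - m + c)))
        + (\<Sum>c<m. smult (s j (n - m + m + c)) (q (n - m + m + c)))"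
    proof -
      have sp: "(\<Sum>k<N + M. f k) = (\<Sum>k<N. f k) + (\<Sum>k<M. f (N + k))" for N M and f :: "nat \<Rightarrow> 'a poly"
        by (induction M) (auto simp: add_ac)
      show ?thesis by (simp only: sp)
    qed
    also have "(\<Sum>k<n - m. smult (s j k) (q k)) = 0"
      using s_low[OF that] by simp
    finally show ?thesis using assms by (simp add: l_def)
  qed
  define Wx1 where "Wx1 = mat m m (\<lambda>(i,j). poly (q (l j)) (z i))"
  define Wy1 where "Wy1 = mat m m (\<lambda>(i,j). poly (q (l j)) (z (m + i)))"
  define Wx2 where "Wx2 = mat m m (\<lambda>(i,j). poly (q (n + j)) (z i))"
  define Wy2 where "Wy2 = mat m m (\<lambda>(i,j). poly (q (n + j)) (z (m + i)))"
  define G1 where "G1 = mat m m (\<lambda>(a,j). s j (l a))"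
  define G2 where "G2 = mat m m (\<lambda>(b,j). s j (n + b))"
  define B where "B = mat m m (\<lambda>(i,j). poly P (z (m + i)) * poly (CD n (z j)) (z (m + i)))"
  have carr: "Wx1 \<in> carrier_mat m m" "Wy1 \<in> carrier_mat m m" "Wx2 \<in> carrier_mat m m"
    "Wy2 \<in> carrier_mat m m" "G1 \<in> carrier_mat m m" "G2 \<in> carrier_mat m m" "B \<in> carrier_mat m m"
    by (auto simp: Wx1_def Wy1_def Wx2_def Wy2_def G1_def G2_def B_def)
  let ?W = "mat (2*m) (2*m) (\<lambda>(i,j). poly (q (n - m + j)) (z i))"
  let ?M = "four_block_mat (0\<^sub>m m m) G1 (1\<^sub>m m) G2"
  have W: "?W = four_block_mat Wx1 Wx2 Wy1 Wy2"
  proof -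
    have idx: "n - m + j = n + (j - m)" if "j \<ge> m" for j
      using that assms by simp
    show ?thesis
      by (rule eq_matI) (auto simp: Wx1_def Wy1_def Wx2_def Wy2_def l_def idx)
  qed
  have val: "Wi1 * G1 + Wi2 * G2 = mat m m (\<lambda>(i,j). poly (S j) (z (k + i)))"
    if "Wi1 = mat m m (\<lambda>(i,j). poly (q (l j)) (z (k + i)))"
       "Wi2 = mat m m (\<lambda>(i,j). poly (q (n + j)) (z (k + i)))" for Wi1 Wi2 k
    using that
    by (intro eq_matI) (auto simp: G1_def G2_def S_exp poly_sum scalar_prod_def lessThan_atLeast0 mult.commute)
  have "?W * ?M = four_block_mat Wx2 (0\<^sub>m m m) Wy2 B"
  proof -
    have "Wx1 * G1 + Wx2 * G2 = 0\<^sub>m m m"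
      by (subst val[of _ 0]) (auto simp: Wx1_def Wx2_def S_def P0 intro!: eq_matI)
    moreover have "Wy1 * G1 + Wy2 * G2 = B"
      by (subst val[of _ m]) (auto simp: Wy1_def Wy2_def B_def S_def intro!: eq_matI)
    ultimately show ?thesis
      unfolding W using carr by (subst mult_four_block_mat[of _ m m _ m _ m _ _ m _ m]) auto
  qed
  moreover have "det (?W * ?M) = det ?W * det ?M"
    using carr by (intro det_mult[of _ "m + m"]) auto
  moreover have "det (four_block_mat Wx2 (0\<^sub>m m m) Wy2 B) = det Wx2 * det B"
    using carr by (intro det_four_block_mat_upper_right_zero) auto
  moreover have "det ?M = (\<Prod>a<m. g (l a)) * det Wx2"
  proof -
    \<comment> \<open>the lower left block is the identity, which commutes with \<open>G2\<close>, so \<open>G2\<close> drops out\<close>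
    have "det ?M = det (0\<^sub>m m m * G2 - G1 * 1\<^sub>m m)"
      using carr by (intro det_four_block_mat) auto
    also have "0\<^sub>m m m * G2 - G1 * 1\<^sub>m m
        = mat m m (\<lambda>(a,b). g (l a) * c a b) * transpose_mat Wx2"
      by (rule eq_matI) (auto simp: G1_def G2_def Wx2_def s_mid scalar_prod_def lessThan_atLeast0
          sum_distrib_left mult.assoc sum_negf)
    also have "det \<dots> = det (mat m m (\<lambda>(a,b). g (l a) * c a b)) * det Wx2"
      using carr by (subst det_mult[of _ m]) (auto simp: det_transpose)
    also have "det (mat m m (\<lambda>(a,b). g (l a) * c a b)) = (\<Prod>a<m. g (l a))"
    proof -
      have c0: "c a b = 0" if "a < b" for a b
        using that assms orth_lower[of "n + b" "P * q (l a)"] degPq[of "l a"]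
        by (auto simp: c_def l_def)
      have c1: "c a a = 1" for a
      proof -
        have "coeff (P * q (l a) - q (n + a)) i = 0" if "i \<ge> n + a" for i
          using that assms degPq[of "l a" i] lcPq[of "l a"] coeff_q_self[of "n + a"]
          by (cases "i = n + a") (auto simp: l_def coeff_q_above)
        then have "\<Lambda> ((P * q (l a) - q (n + a)) * q (n + a)) = 0"
          by (rule orth_lower)
        moreover have "P * q (l a) * q (n + a)
            = (P * q (l a) - q (n + a)) * q (n + a) + q (n + a) * q (n + a)"
          by (simp add: algebra_simps)
        ultimately have "\<Lambda> (P * q (l a) * q (n + a)) = \<Lambda> (q (n + a) * q (n + a))"
          by (simp add: L_add)
        then show ?thesis by (simp add: c_def inverse_sqnorm)
      qed
      have "det (mat m m (\<lambda>(a,b). g (l a) * c a b))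
          = prod_list (diag_mat (mat m m (\<lambda>(a,b). g (l a) * c a b)))"
        by (rule det_lower_triangular[of m]) (auto simp: c0)
      then show ?thesis by (simp add: prod_list_diag_prod c1 lessThan_atLeast0)
    qed
    finally show ?thesis .
  qed
  moreover have "det B = (\<Prod>i<m. \<Prod>j<m. z (m + i) - z j)
      * det (mat m m (\<lambda>(i,j). poly (CD n (z j)) (z (m + i))))"
  proof -
    define K where "K = mat m m (\<lambda>(i,j). poly (CD n (z j)) (z (m + i)))"
    define D where "D = mat m m (\<lambda>(i,j). if i = j then poly P (z (m + i)) else 0)"
    have "B = D * K"
      by (rule eq_matI) (auto simp: B_def D_def K_def scalar_prod_def if_distrib if_distribR cong: if_cong)
    then have "det B = det D * det K"
      by (simp add: det_mult[of _ m] D_def K_def)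
    also have "det D = (\<Prod>i<m. poly P (z (m + i)))"
    proof -
      have "det D = prod_list (diag_mat D)"
        by (rule det_lower_triangular[of m]) (auto simp: D_def)
      then show ?thesis by (simp add: prod_list_diag_prod D_def lessThan_atLeast0)
    qed
    finally show ?thesis by (simp add: P_def poly_prod K_def)
  qed
  ultimately have "det ?W * ((\<Prod>a<m. g (l a)) * det Wx2)
      = det Wx2 * ((\<Prod>i<m. \<Prod>j<m. z (m + i) - z j)
          * det (mat m m (\<lambda>(i,j). poly (CD n (z j)) (z (m + i)))))"
    by auto
  then show ?thesis
    unfolding l_def Wx2_def mult.assoc by (simp only: mult_ac)
qed

text \<open>
  A Cauchy--Binet formula. Summing over all maps \<open>k\<close> instead of increasing ones makes each
  nonzero summand occur \<open>m!\<close> times, which accounts for the factor on the left. Expanding the kernels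
  yields \<open>\<Prod>j<m. q (k j) (x j)\<close> in place of the first determinant; it is antisymmetrised because
  the left-hand side is antisymmetric in \<open>x\<close>.
\<close>

lemma det_CD_sum:
  "of_nat (fact m) * det (mat m m (\<lambda>(i,j). poly (CD n (x j)) (y i)))
    = (\<Sum>k\<in>PiE {..<m} (\<lambda>_. {..<n}). (\<Prod>i<m. g (k i))
        * det (mat m m (\<lambda>(i,j). poly (q (k i)) (x j)))
        * det (mat m m (\<lambda>(i,j). poly (q (k i)) (y j))))"
proof -
  let ?F = "PiE {..<m} (\<lambda>_. {..<n})"
  let ?S = "{\<sigma>. \<sigma> permutes {..<m}}"
  let ?K = "\<lambda>x. det (mat m m (\<lambda>(i,j). poly (CD n (x j)) (y i)))"
  let ?Q = "\<lambda>k y. det (mat m m (\<lambda>(i,j). poly (q (k i)) (y j)))"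
  have one: "?K x = (\<Sum>k\<in>?F. (\<Prod>i<m. g (k i)) * (\<Prod>j<m. poly (q (k j)) (x j)) * ?Q k y)" for x
  proof -
    have "?K x = (\<Sum>p\<in>?S. of_int (sign p) * (\<Prod>j<m. poly (CD n (x j)) (y (p j))))"
      by (simp add: det_mat_columns)
    also have "\<dots> = (\<Sum>p\<in>?S. signof p *
        (\<Sum>k\<in>?F. \<Prod>j<m. g (k j) * poly (q (k j)) (x j) * poly (q (k j)) (y (p j))))"
      by (simp add: CD_def poly_sum prod_sum_PiE)
    also have "\<dots> = (\<Sum>k\<in>?F. \<Sum>p\<in>?S. (\<Prod>i<m. g (k i)) * (\<Prod>j<m. poly (q (k j)) (x j)) *
        (signof p * (\<Prod>j<m. poly (q (k j)) (y (p j)))))"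
      by (subst sum.swap) (simp add: sum_distrib_left prod.distrib mult_ac)
    also have "\<dots> = (\<Sum>k\<in>?F. (\<Prod>i<m. g (k i)) * (\<Prod>j<m. poly (q (k j)) (x j)) * ?Q k y)"
      by (simp add: det_mat_rows sum_distrib_left)
    finally show ?thesis .
  qed
  have "of_nat (fact m) * ?K x = (\<Sum>\<sigma>\<in>?S. ?K x)"
    by (simp add: card_permutations[of _ m])
  also have "\<dots> = (\<Sum>\<sigma>\<in>?S. signof \<sigma> * ?K (\<lambda>j. x (\<sigma> j)))"
  proof (rule sum.cong)
    fix \<sigma> assume "\<sigma> \<in> ?S"
    then have "?K (\<lambda>j. x (\<sigma> j)) = signof \<sigma> * ?K x"
      using det_permute_columns[of \<sigma> m "\<lambda>i j. poly (CD n (x j)) (y i)"] by simp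
    then show "?K x = signof \<sigma> * ?K (\<lambda>j. x (\<sigma> j))"
      by (simp add: sign_def)
  qed simp
  also have "\<dots> = (\<Sum>k\<in>?F. \<Sum>\<sigma>\<in>?S. (\<Prod>i<m. g (k i)) *
      (signof \<sigma> * (\<Prod>j<m. poly (q (k j)) (x (\<sigma> j)))) * ?Q k y)"
    by (subst sum.swap) (simp add: one sum_distrib_left mult_ac)
  also have "\<dots> = (\<Sum>k\<in>?F. (\<Prod>i<m. g (k i)) * ?Q k x * ?Q k y)"
    by (simp add: det_mat_rows[of m "\<lambda>i j. poly (q (_ i)) (x j)"] sum_distrib_left sum_distrib_right)
  finally show ?thesis .
qed

end

section \<open>The ring of polynomials in several variables\<close>

abbreviation "keys \<equiv> Poly_Mapping.keys"
abbreviation "lookup \<equiv> Poly_Mapping.lookup"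
abbreviation "single \<equiv> Poly_Mapping.single"

lemma sum_of_singles: "f = (\<Sum>a\<in>keys f. single a (lookup f a))"
proof (rule poly_mapping_eqI)
  fix k
  have "lookup (\<Sum>a\<in>keys f. single a (lookup f a)) k = (\<Sum>a\<in>keys f. if a = k then lookup f a else 0)"
    by (simp add: lookup_sum lookup_single when_def)
  then show "lookup f k = lookup (\<Sum>a\<in>keys f. single a (lookup f a)) k"
    by (simp add: in_keys_iff)
qed

lemma comm_ring_hom_Const: "comm_ring_hom Const"
  by unfold_locales (auto simp: Const_def single_add mult_single)

interpretation Const: comm_ring_hom Const by (rule comm_ring_hom_Const)

lemma map_poly_Const_mult: "map_poly Const (f * g) = map_poly Const f * map_poly Const g"
  by (rule poly_eqI) (simp add: coeff_map_poly coeff_mult Const.hom_sum Const.hom_mult)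

lemma Const_eq_iff [simp]: "Const a = Const b \<longleftrightarrow> a = b"
  by (simp add: Const_def inj_eq)

lemma Const_eq_0_iff: "Const a = 0 \<longleftrightarrow> a = 0"
  by (metis Const_eq_iff Const.hom_zero)

lemma X_power: "X i ^ k = single (single i k) 1"
  by (induction k) (simp_all add: X_def mult_single single_add[symmetric] add.commute)

lemma prod_X_power: "finite I \<Longrightarrow> (\<Prod>i\<in>I. X i ^ e i) = single (\<Sum>i\<in>I. single i (e i)) 1"
  by (induction I rule: finite_induct) (simp_all add: X_power mult_single)

lemma Const_mult_single: "Const c * single a d = single a (c * d)"
  by (simp add: Const_def mult_single)

lemma single_conv_prod:
  assumes "finite I" "keys a \<subseteq> I"
  shows "single a c = Const c * (\<Prod>i\<in>I. X i ^ lookup a i)"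
proof -
  have "(\<Sum>i\<in>I. single i (lookup a i)) = a"
    using assms by (subst (3) sum_of_singles, intro sum.mono_neutral_right) (auto simp: in_keys_iff)
  then show ?thesis using assms by (simp add: prod_X_power Const_mult_single)
qed

section \<open>Substitution\<close>

lemma msubst_superset:
  assumes "finite A" "keys f \<subseteq> A"
  shows "msubst \<theta> f = (\<Sum>a\<in>A. Const (lookup f a) * (\<Prod>i\<in>keys a. \<theta> i ^ lookup a i))"
  unfolding msubst_def using assms
  by (intro sum.mono_neutral_left) (auto simp: in_keys_iff)

lemma msubst_add: "msubst \<theta> (f + g) = msubst \<theta> f + msubst \<theta> g"
proof -
  let ?A = "keys f \<union> keys g"
  have "keys (f + g) \<subseteq> ?A" by (rule keys_add)
  then show ?thesis
    by (simp add: msubst_superset[of ?A] lookup_add Const.hom_add distrib_right sum.distrib)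
qed

lemma msubst_0 [simp]: "msubst \<theta> 0 = 0"
  by (simp add: msubst_def)

lemma msubst_sum: "msubst \<theta> (\<Sum>i\<in>I. f i) = (\<Sum>i\<in>I. msubst \<theta> (f i))"
  by (induction I rule: infinite_finite_induct) (auto simp: msubst_add)

lemma msubst_single: "msubst \<theta> (single a c) = Const c * (\<Prod>i\<in>keys a. \<theta> i ^ lookup a i)"
  by (simp add: msubst_def)

lemma msubst_single_mult: "msubst \<theta> (single a c * single b d) = msubst \<theta> (single a c) * msubst \<theta> (single b d)"
proof -
  let ?I = "keys a \<union> keys b"
  have sup: "(\<Prod>i\<in>keys e. \<theta> i ^ lookup e i) = (\<Prod>i\<in>?I. \<theta> i ^ lookup e i)" if "keys e \<subseteq> ?I" for e
    using that by (intro prod.mono_neutral_left) (auto simp: in_keys_iff)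
  have "msubst \<theta> (single (a + b) (c * d)) = Const (c * d) * (\<Prod>i\<in>?I. \<theta> i ^ lookup (a + b) i)"
    unfolding msubst_single sup[OF keys_add] ..
  then show ?thesis
    by (simp add: mult_single msubst_single sup[of a] sup[of b] lookup_add power_add
        prod.distrib Const.hom_mult mult_ac)
qed

lemma msubst_mult: "msubst \<theta> (f * g) = msubst \<theta> f * msubst \<theta> g"
proof -
  have "msubst \<theta> (f * g) = msubst \<theta> (\<Sum>a\<in>keys f. \<Sum>b\<in>keys g. single a (lookup f a) * single b (lookup g b))"
    by (subst sum_of_singles[of f], subst sum_of_singles[of g]) (simp add: sum_product)
  also have "\<dots> = (\<Sum>a\<in>keys f. \<Sum>b\<in>keys g. msubst \<theta> (single a (lookup f a)) * msubst \<theta> (single b (lookup g b)))"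
    by (simp add: msubst_sum msubst_single_mult)
  also have "\<dots> = msubst \<theta> (\<Sum>a\<in>keys f. single a (lookup f a)) * msubst \<theta> (\<Sum>b\<in>keys g. single b (lookup g b))"
    unfolding msubst_sum sum_product ..
  finally show ?thesis by (simp flip: sum_of_singles)
qed

lemma msubst_Const [simp]: "msubst \<theta> (Const c) = Const c"
  by (simp add: Const_def msubst_single)

lemma comm_ring_hom_msubst: "comm_ring_hom (msubst \<theta>)"
  by unfold_locales (auto simp: msubst_add msubst_mult msubst_Const[of \<theta> 1, unfolded Const_def, simplified])

interpretation msubst: comm_ring_hom "msubst \<theta>" for \<theta> by (rule comm_ring_hom_msubst)

lemma msubst_X [simp]: "msubst \<theta> (X i) = \<theta> i"
  by (simp add: X_def msubst_single Const_def)

lemma univ_at_sum: "univ_at f t = (\<Sum>k\<le>degree f. Const (coeff f k) * t ^ k)"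
proof -
  have "degree (map_poly Const f) = degree f"
    by (rule degree_map_poly) (metis Const_eq_iff Const.hom_zero)
  then show ?thesis
    by (simp add: univ_at_def poly_altdef coeff_map_poly)
qed

lemma msubst_univ_at: "msubst \<theta> (univ_at f t) = univ_at f (msubst \<theta> t)"
  by (simp add: univ_at_sum msubst.hom_sum msubst_mult msubst.hom_power)

section \<open>Polynomials in a subset of the variables\<close>

definition in_vars :: "nat set \<Rightarrow> mpoly \<Rightarrow> bool" where
  "in_vars I f \<longleftrightarrow> (\<forall>a\<in>keys f. keys a \<subseteq> I)"

lemma in_vars_mono: "in_vars I f \<Longrightarrow> I \<subseteq> J \<Longrightarrow> in_vars J f"
  by (auto simp: in_vars_def)

lemma in_vars_Const [simp]: "in_vars I (Const c)"
  by (auto simp: in_vars_def Const_def)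

lemma in_vars_0 [simp]: "in_vars I 0"
  by (auto simp: in_vars_def)

lemma in_vars_1 [simp]: "in_vars I 1"
  using in_vars_Const[of I 1] by (simp only: Const.hom_one)

lemma in_vars_X: "i \<in> I \<Longrightarrow> in_vars I (X i)"
  by (auto simp: in_vars_def X_def)

lemma in_vars_add: "in_vars I f \<Longrightarrow> in_vars I g \<Longrightarrow> in_vars I (f + g)"
  using keys_add[of f g] by (auto simp: in_vars_def)

lemma in_vars_mult: "in_vars I f \<Longrightarrow> in_vars I g \<Longrightarrow> in_vars I (f * g)"
proof -
  assume *: "in_vars I f" "in_vars I g"
  show ?thesis
    unfolding in_vars_def
  proof
    fix c assume "c \<in> keys (f * g)"
    then obtain a b where "a \<in> keys f" "b \<in> keys g" "c = a + b"
      using keys_mult[of f g] by blast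
    moreover have "keys (a + b) \<subseteq> keys a \<union> keys b" by (rule keys_add)
    ultimately show "keys c \<subseteq> I" using * unfolding in_vars_def by blast
  qed
qed

lemma in_vars_power: "in_vars I f \<Longrightarrow> in_vars I (f ^ k)"
  by (induction k) (auto intro: in_vars_mult)

lemma in_vars_sum: "(\<And>i. i \<in> A \<Longrightarrow> in_vars I (f i)) \<Longrightarrow> in_vars I (\<Sum>i\<in>A. f i)"
  by (induction A rule: infinite_finite_induct) (auto intro: in_vars_add)

lemma in_vars_prod: "(\<And>i. i \<in> A \<Longrightarrow> in_vars I (f i)) \<Longrightarrow> in_vars I (\<Prod>i\<in>A. f i)"
  by (induction A rule: infinite_finite_induct) (auto intro: in_vars_mult)

lemma in_vars_univ_at: "in_vars I t \<Longrightarrow> in_vars I (univ_at f t)"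
  by (auto simp: univ_at_sum intro!: in_vars_sum in_vars_mult in_vars_power)

lemma in_vars_empty: "in_vars {} f \<Longrightarrow> \<exists>c. f = Const c"
proof -
  assume "in_vars {} f"
  then have "keys f \<subseteq> {0}" by (auto simp: in_vars_def)
  then have "f = single 0 (lookup f 0)"
    by (intro poly_mapping_eqI) (auto simp: lookup_single when_def in_keys_iff)
  then show ?thesis unfolding Const_def by blast
qed

section \<open>Integrating out one variable\<close>

lemma integrate_var_superset:
  assumes "finite A" "keys f \<subseteq> A"
  shows "integrate_var L i f = (\<Sum>a\<in>A. single (Poly_Mapping.update i 0 a) (lookup f a * L (monom 1 (lookup a i))))"
  unfolding integrate_var_def using assms
  by (intro sum.mono_neutral_left) (auto simp: in_keys_iff)

lemma integrate_var_add: "integrate_var L i (f + g) = integrate_var L i f + integrate_var L i g"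
proof -
  let ?A = "keys f \<union> keys g"
  have "keys (f + g) \<subseteq> ?A" by (rule keys_add)
  then show ?thesis
    by (simp add: integrate_var_superset[of ?A] lookup_add distrib_right single_add sum.distrib)
qed

lemma integrate_var_0 [simp]: "integrate_var L i 0 = 0"
  by (simp add: integrate_var_def)

lemma integrate_var_sum: "integrate_var L i (\<Sum>k\<in>K. f k) = (\<Sum>k\<in>K. integrate_var L i (f k))"
  by (induction K rule: infinite_finite_induct) (auto simp: integrate_var_add)

lemma integrate_var_single:
  "integrate_var L i (single a c) = single (Poly_Mapping.update i 0 a) (c * L (monom 1 (lookup a i)))"
  by (simp add: integrate_var_def)

text \<open>
  The functional acts on one variable and treats the others as scalars.
\<close>

lemma integrate_var_mult_left:
  assumes "in_vars (- {i}) f"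
  shows "integrate_var L i (f * g) = f * integrate_var L i g"
proof -
  have s: "integrate_var L i (single a c * single b d) = single a c * integrate_var L i (single b d)"
    if "a \<in> keys f" for a b c d
  proof -
    have a: "lookup a i = 0" using that assms by (auto simp: in_vars_def in_keys_iff)
    have "Poly_Mapping.update i 0 (a + b) = a + Poly_Mapping.update i 0 b"
      by (rule poly_mapping_eqI) (auto simp: lookup_update lookup_add a)
    then show ?thesis
      by (simp add: mult_single integrate_var_single lookup_add a mult.assoc)
  qed
  have "integrate_var L i (f * g)
      = integrate_var L i (\<Sum>a\<in>keys f. \<Sum>b\<in>keys g. single a (lookup f a) * single b (lookup g b))"
    by (subst sum_of_singles[of f], subst sum_of_singles[of g]) (simp add: sum_product)
  also have "\<dots> = (\<Sum>a\<in>keys f. \<Sum>b\<in>keys g. single a (lookup f a) * integrate_var L i (single b (lookup g b)))"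
    by (simp add: integrate_var_sum s)
  also have "\<dots> = (\<Sum>a\<in>keys f. single a (lookup f a)) * integrate_var L i (\<Sum>b\<in>keys g. single b (lookup g b))"
    unfolding integrate_var_sum sum_product ..
  finally show ?thesis by (simp flip: sum_of_singles)
qed

lemma integrate_var_X_power: "integrate_var L i (X i ^ k) = Const (L (monom 1 k))"
proof -
  have "Poly_Mapping.update i 0 (single i k) = 0"
    by (rule poly_mapping_eqI) (auto simp: lookup_update lookup_single)
  then show ?thesis by (simp add: X_power integrate_var_single Const_def)
qed

lemma in_vars_integrate_var:
  assumes "in_vars I f"
  shows "in_vars (I - {i}) (integrate_var L i f)"
  unfolding integrate_var_def
proof (rule in_vars_sum)
  fix a assume "a \<in> keys f"
  then have "keys a \<subseteq> I" using assms by (auto simp: in_vars_def)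
  then have "keys (Poly_Mapping.update i 0 a) \<subseteq> I - {i}"
    by (auto simp: in_keys_iff lookup_update split: if_splits)
  then show "in_vars (I - {i}) (single (Poly_Mapping.update i 0 a) (lookup f a * L (monom 1 (lookup a i))))"
    by (auto simp: in_vars_def)
qed

text \<open>
  The functional extended to polynomials with coefficients in the multivariate ring. Integrating
  over one variable amounts to regarding the integrand as a univariate polynomial and applying
  this extension, which connects \<open>integrate_var\<close> to the orthogonal polynomials above.
\<close>

definition extend :: "(complex poly \<Rightarrow> complex) \<Rightarrow> mpoly poly \<Rightarrow> mpoly" where
  "extend L F = (\<Sum>k\<le>degree F. coeff F k * Const (L (monom 1 k)))"

lemma extend_bound: "degree F \<le> N \<Longrightarrow> extend L F = (\<Sum>k\<le>N. coeff F k * Const (L (monom 1 k)))"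
  unfolding extend_def by (intro sum.mono_neutral_left) (auto simp: coeff_eq_0)

lemma extend_add: "extend L (F + G) = extend L F + extend L G"
proof -
  let ?N = "max (degree F) (degree G)"
  have "degree (F + G) \<le> ?N" by (rule degree_add_le_max)
  then show ?thesis
    by (simp add: extend_bound[of _ ?N] distrib_right sum.distrib)
qed

lemma extend_smult: "extend L (smult c F) = c * extend L F"
  using degree_smult_le[of c F] by (simp add: extend_bound[of _ "degree F"] sum_distrib_left mult.assoc)

lemma integrate_var_poly:
  assumes "\<And>k. in_vars (- {i}) (coeff F k)"
  shows "integrate_var L i (poly F (X i)) = extend L F"
  by (simp add: poly_altdef integrate_var_sum integrate_var_mult_left assms integrate_var_X_power extend_def)

lemma extend_map_poly_Const:
  assumes "Vector_Spaces.linear smult (*) L"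
  shows "extend L (map_poly Const f) = Const (L f)"
proof -
  interpret L: Vector_Spaces.linear smult "(*)" L by (rule assms)
  have "degree (map_poly Const f) \<le> degree f" by (intro degree_le) (auto simp: coeff_map_poly coeff_eq_0)
  then have "extend L (map_poly Const f) = Const (\<Sum>k\<le>degree f. coeff f k * L (monom 1 k))"
    by (simp add: extend_bound coeff_map_poly Const.hom_sum Const.hom_mult)
  also have "(\<Sum>k\<le>degree f. coeff f k * L (monom 1 k)) = L (\<Sum>k\<le>degree f. smult (coeff f k) (monom 1 k))"
    by (simp add: L.sum L.scale)
  also have "(\<Sum>k\<le>degree f. smult (coeff f k) (monom 1 k)) = f"
    by (simp add: smult_monom poly_as_sum_of_monoms)
  finally show ?thesis .
qed

section \<open>Iterated integration\<close>

abbreviation "integrals L xs f \<equiv> foldr (integrate_var L) xs f"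

lemma integrals_0 [simp]: "integrals L xs 0 = 0"
  by (induction xs) auto

lemma integrals_add: "integrals L xs (f + g) = integrals L xs f + integrals L xs g"
  by (induction xs) (auto simp: integrate_var_add)

lemma integrals_sum: "integrals L xs (\<Sum>k\<in>K. f k) = (\<Sum>k\<in>K. integrals L xs (f k))"
  by (induction K rule: infinite_finite_induct) (auto simp: integrals_add)

lemma integrals_mult_left: "in_vars (- set xs) f \<Longrightarrow> integrals L xs (f * g) = f * integrals L xs g"
proof (induction xs)
  case (Cons x xs)
  have "in_vars (- set xs) f" "in_vars (- {x}) f"
    using Cons.prems by (auto elim: in_vars_mono)
  then show ?case using Cons.IH by (simp add: integrate_var_mult_left)
qed simp

lemma in_vars_integrals: "in_vars I f \<Longrightarrow> in_vars (I - set xs) (integrals L xs f)"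
proof (induction xs)
  case (Cons x xs)
  then show ?case
    using in_vars_integrate_var[of "I - set xs" "integrals L xs f" x L]
    by (auto elim!: in_vars_mono)
qed simp

text \<open>
  A product of functions of separate variables, times a factor \<open>A\<close> constant in them, integrates
  factor by factor. Each \<open>G i\<close> may depend on variables that are not integrated.
\<close>

lemma integrals_prod:
  assumes "distinct xs" "in_vars (- set xs) A"
    and "\<And>i. i \<in> set xs \<Longrightarrow> in_vars (- (set xs - {i})) (G i)"
  shows "integrals L xs (A * (\<Prod>i\<in>set xs. G i)) = A * (\<Prod>i\<in>set xs. integrate_var L i (G i))"
  using assms
proof (induction xs arbitrary: A)
  case (Cons x xs)
  have G: "in_vars (- (set (x # xs) - {i})) (G i)" if "i \<in> set (x # xs)" for i
    using Cons.prems that by blast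
  have "in_vars (- set xs) (A * G x)"
    using Cons.prems(2) G[of x] Cons.prems(1) by (intro in_vars_mult) (auto elim!: in_vars_mono)
  moreover have "in_vars (- (set xs - {i})) (G i)" if "i \<in> set xs" for i
    using G[of i] that by (auto elim!: in_vars_mono)
  ultimately have "integrals L xs (A * G x * (\<Prod>i\<in>set xs. G i))
      = A * G x * (\<Prod>i\<in>set xs. integrate_var L i (G i))"
    using Cons.prems(1) by (intro Cons.IH) auto
  then have "integrals L (x # xs) (A * (\<Prod>i\<in>set (x # xs). G i))
      = integrate_var L x ((A * (\<Prod>i\<in>set xs. integrate_var L i (G i))) * G x)"
    using Cons.prems(1) by (simp add: mult_ac)
  also have "\<dots> = (A * (\<Prod>i\<in>set xs. integrate_var L i (G i))) * integrate_var L x (G x)"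
  proof (intro integrate_var_mult_left in_vars_mult in_vars_prod)
    show "in_vars (- {x}) A" using Cons.prems(2) by (auto elim!: in_vars_mono)
    fix i assume i: "i \<in> set xs"
    have "in_vars (- {x} - {i}) (integrate_var L i (G i))"
      using G[of i] i Cons.prems(1) by (intro in_vars_integrate_var) (auto elim!: in_vars_mono)
    then show "in_vars (- {x}) (integrate_var L i (G i))" by (auto elim: in_vars_mono)
  qed
  finally show ?case using Cons.prems(1) by (simp add: mult_ac)
qed simp

lemma integrals_prod_upt:
  assumes "in_vars (- {s..<s + m}) A"
    and "\<And>i. i < m \<Longrightarrow> in_vars (- ({s..<s + m} - {s + i})) (G i)"
  shows "integrals L [s..<s + m] (A * (\<Prod>i<m. G i)) = A * (\<Prod>i<m. integrate_var L (s + i) (G i))"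
proof -
  have sh: "(\<Prod>i\<in>set [s..<s + m]. F i) = (\<Prod>i<m. F (s + i))" for F :: "nat \<Rightarrow> mpoly"
    by (rule prod.reindex_bij_witness[of _ "\<lambda>i. s + i" "\<lambda>i. i - s"]) auto
  have "in_vars (- (set [s..<s + m] - {i})) (G (i - s))" if "i \<in> set [s..<s + m]" for i
    using assms(2)[of "i - s"] that by auto
  then have "integrals L [s..<s + m] (A * (\<Prod>i\<in>set [s..<s + m]. G (i - s)))
      = A * (\<Prod>i\<in>set [s..<s + m]. integrate_var L i (G (i - s)))"
    using assms(1) by (intro integrals_prod) auto
  then show ?thesis unfolding sh by simp
qed

lemma integrate_vars_sum: "integrate_vars L s m (\<Sum>k\<in>K. f k) = (\<Sum>k\<in>K. integrate_vars L s m (f k))"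
  by (simp add: integrate_vars_def integrals_sum sum_distrib_left)

lemma integrate_vars_mult_left:
  "in_vars (- {s..<s + m}) f \<Longrightarrow> integrate_vars L s m (f * g) = f * integrate_vars L s m g"
  by (simp add: integrate_vars_def integrals_mult_left mult_ac)

lemma integrate_vars_const:
  assumes "in_vars {s..<s + m} f"
  shows "\<exists>c. integrate_vars L s m f = Const c"
  unfolding integrate_vars_def
  using in_vars_integrals[OF assms, of "[s..<s + m]" L] by (intro in_vars_empty in_vars_mult) auto

section \<open>The space of antisymmetric polynomials\<close>

text \<open>
  The condition on exponents in \<open>antisym_space\<close> for an arbitrary set of variables, which allows
  products to be built one variable at a time.
\<close>

definition box :: "nat set \<Rightarrow> nat \<Rightarrow> mpoly \<Rightarrow> bool" where
  "box I n f \<longleftrightarrow> (\<forall>a\<in>keys f. keys a \<subseteq> I \<and> (\<forall>i\<in>I. lookup a i < n))"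

lemma antisym_space_iff:
  "f \<in> antisym_space n m \<longleftrightarrow> box {..<m} n f \<and>
    (\<forall>\<sigma>. \<sigma> permutes {..<m} \<longrightarrow> msubst (\<lambda>i. X (\<sigma> i)) f = of_int (sign \<sigma>) * f)"
  by (auto simp: antisym_space_def box_def)

lemma box_in_vars: "box I n f \<Longrightarrow> in_vars I f"
  by (auto simp: box_def in_vars_def)

lemma box_add: "box I n f \<Longrightarrow> box I n g \<Longrightarrow> box I n (f + g)"
  using keys_add[of f g] by (auto simp: box_def)

lemma box_sum: "(\<And>i. i \<in> A \<Longrightarrow> box I n (f i)) \<Longrightarrow> box I n (\<Sum>i\<in>A. f i)"
  by (induction A rule: infinite_finite_induct) (auto intro: box_add simp: box_def[of _ _ 0])

lemma box_mult:
  assumes "box I n f" "box J n g" "I \<inter> J = {}"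
  shows "box (I \<union> J) n (f * g)"
  unfolding box_def
proof
  fix c assume "c \<in> keys (f * g)"
  then obtain a b where ab: "a \<in> keys f" "b \<in> keys g" "c = a + b"
    using keys_mult[of f g] by blast
  have a: "keys a \<subseteq> I" "\<forall>i\<in>I. lookup a i < n" and b: "keys b \<subseteq> J" "\<forall>i\<in>J. lookup b i < n"
    using ab assms by (auto simp: box_def)
  have "lookup b i = 0" if "i \<in> I" for i
    using b(1) assms(3) that by (auto simp: in_keys_iff)
  moreover have "lookup a i = 0" if "i \<in> J" for i
    using a(1) assms(3) that by (auto simp: in_keys_iff)
  moreover have "keys (a + b) \<subseteq> keys a \<union> keys b" by (rule keys_add)
  ultimately show "keys c \<subseteq> I \<union> J \<and> (\<forall>i\<in>I \<union> J. lookup c i < n)"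
    using a b ab(3) by (auto simp: lookup_add)
qed

lemma box_Const_mult: "box I n f \<Longrightarrow> box I n (Const c * f)"
  using box_mult[of "{}" n "Const c" I f] by (auto simp: box_def[of "{}"] Const_def)

lemma box_of_int_mult: "box I n f \<Longrightarrow> box I n (of_int c * f)"
  using box_Const_mult[of I n f "of_int c"] by (simp add: Const_def)

lemma box_prod:
  assumes "finite I" "\<And>i. i \<in> I \<Longrightarrow> box {i} n (f i)"
  shows "box I n (\<Prod>i\<in>I. f i)"
  using assms
proof (induction I rule: finite_induct)
  case empty
  then show ?case by (simp add: box_def)
next
  case (insert x I)
  then show ?case using box_mult[of "{x}" n "f x" I "\<Prod>i\<in>I. f i"] by simp
qed

lemma box_univ_at:
  assumes "degree f < n"
  shows "box {i} n (univ_at f (X i))"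
  unfolding univ_at_sum
proof (intro box_sum box_Const_mult)
  fix k assume "k \<in> {..degree f}"
  then show "box {i} n (X i ^ k)"
    using assms by (auto simp: box_def X_power)
qed

lemma box_expansion:
  assumes "box {..<m} n f"
  shows "f = (\<Sum>a\<in>keys f. Const (lookup f a) * (\<Prod>i<m. X i ^ lookup a i))"
proof -
  have "single a (lookup f a) = Const (lookup f a) * (\<Prod>i<m. X i ^ lookup a i)" if "a \<in> keys f" for a
    using assms that by (intro single_conv_prod) (auto simp: box_def)
  then show ?thesis by (subst sum_of_singles) simp
qed

lemma msubst_box:
  assumes "box {..<m} n f"
  shows "msubst \<theta> f = (\<Sum>a\<in>keys f. Const (lookup f a) * (\<Prod>i<m. \<theta> i ^ lookup a i))"
  by (subst box_expansion[OF assms])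
     (simp add: msubst.hom_sum msubst_mult msubst.hom_prod msubst.hom_power)

definition alternant :: "(nat \<Rightarrow> complex poly) \<Rightarrow> nat \<Rightarrow> (nat \<Rightarrow> mpoly) \<Rightarrow> mpoly" where
  "alternant f m t = det (mat m m (\<lambda>(i,j). univ_at (f i) (t j)))"

lemma msubst_alternant: "msubst \<theta> (alternant f m t) = alternant f m (\<lambda>i. msubst \<theta> (t i))"
proof -
  have "map_mat (msubst \<theta>) (mat m m (\<lambda>(i,j). univ_at (f i) (t j)))
      = mat m m (\<lambda>(i,j). univ_at (f i) (msubst \<theta> (t j)))"
    by (intro eq_matI) (auto simp: msubst_univ_at)
  then show ?thesis
    unfolding alternant_def msubst.hom_det[symmetric] by (rule arg_cong)
qed

lemma alternant_antisym:
  assumes "\<And>i. i < m \<Longrightarrow> degree (f i) < n"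
  shows "alternant f m X \<in> antisym_space n m"
  unfolding antisym_space_iff
proof (intro conjI allI impI)
  have d: "degree (f (\<sigma> j)) < n" if "\<sigma> permutes {..<m}" "j < m" for \<sigma> j
    using assms permutes_in_image[OF that(1)] that(2) by auto
  show "box {..<m} n (alternant f m X)"
    unfolding alternant_def det_mat_columns
    by (intro box_sum box_of_int_mult box_prod box_univ_at d) auto
  fix \<sigma> assume "\<sigma> permutes {..<m}"
  then show "msubst (\<lambda>i. X (\<sigma> i)) (alternant f m X) = of_int (sign \<sigma>) * alternant f m X"
    unfolding msubst_alternant by (simp add: alternant_def det_permute_columns[of \<sigma> m "\<lambda>i j. univ_at (f i) (X j)"])
qed

lemma antisym_space_Const_mult: "f \<in> antisym_space n m \<Longrightarrow> Const c * f \<in> antisym_space n m"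
  by (auto simp: antisym_space_iff box_Const_mult msubst_mult)

lemma in_vars_to_y:
  assumes "in_vars {..<m} f"
  shows "in_vars {m..<m + m} (to_y m f)"
  unfolding to_y_def msubst_def
proof (intro in_vars_sum in_vars_mult in_vars_prod in_vars_power in_vars_X in_vars_Const)
  fix a i assume "a \<in> keys f" "i \<in> keys a"
  then have "i \<in> {..<m}" using assms unfolding in_vars_def by blast
  then show "m + i \<in> {m..<m + m}" by simp
qed

lemma Delta_X_nonzero: "Delta k X \<noteq> 0"
proof -
  have "X j \<noteq> X i" if "i < j" for i j
  proof
    assume "X j = X i"
    then have "lookup (X j) (single j 1) = lookup (X i) (single j 1)" by (rule arg_cong)
    then have "single i (1::nat) = single j 1" by (simp add: X_def lookup_single when_def split: if_splits)
    then have "lookup (single i (1::nat)) i = lookup (single j 1) i" by (rule arg_cong)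
    then show False using that by (simp add: lookup_single)
  qed
  then show ?thesis by (auto simp: Delta_def)
qed

lemma univ_at_mult: "univ_at (f * g) t = univ_at f t * univ_at g t"
  by (simp add: univ_at_def map_poly_Const_mult)

section \<open>The kernel of a moment functional\<close>

locale moment_functional =
  fixes L :: "complex poly \<Rightarrow> complex" and p :: "nat \<Rightarrow> complex poly"
  assumes linear_L: "Vector_Spaces.linear smult (*) L"
    and nondegenerate: "k \<ge> 1 \<Longrightarrow> nondegenerate_on L (polys_upto k)"
    and monic_orthogonal: "monic_orthogonal L p"
begin

sublocale L: Vector_Spaces.linear smult "(*)" L by (rule linear_L)

definition h :: "nat \<Rightarrow> complex" where
  "h k = pairing L (p k) (p k)"

lemma degree_p: "degree (p k) = k"
  and coeff_p: "coeff (p k) k = 1"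
  and pairing_p: "j \<noteq> k \<Longrightarrow> pairing L (p j) (p k) = 0"
  using monic_orthogonal unfolding monic_orthogonal_def by metis+

text \<open>
  A \<open>p k\<close> of norm zero would be orthogonal to all polynomials of degree at most \<open>k\<close>,
  contradicting nondegeneracy.
\<close>

lemma h_nonzero: "h k \<noteq> 0"
proof
  assume h0: "h k = 0"
  interpret p: monic_sequence p by unfold_locales (simp_all add: degree_p coeff_p)
  have "pairing L (p k) f = 0" if "f \<in> polys_upto (k + 1)" for f
  proof -
    have "\<exists>c. f = (\<Sum>j<k + 1. smult (c j) (p j))"
      using that by (intro p.ex_expansion coeff_eq_0) (auto simp: polys_upto_def)
    then obtain c where "f = (\<Sum>j<k + 1. smult (c j) (p j))" by blast
    then have "pairing L (p k) f = (\<Sum>j<k + 1. c j * pairing L (p k) (p j))"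
      by (simp add: pairing_def sum_distrib_left L.sum L.scale L.add distrib_left)
    also have "\<dots> = 0"
      using h0 pairing_p[of k] by (intro sum.neutral) (metis h_def mult_zero_right)
    finally show ?thesis .
  qed
  moreover have "p k \<in> polys_upto (k + 1)" by (simp add: polys_upto_def degree_p)
  ultimately have "p k = 0"
    using nondegenerate[of "k + 1"] by (auto simp: nondegenerate_on_def)
  then show False using coeff_p[of k] by simp
qed

text \<open>
  The orthogonal polynomials, with their coefficients regarded as constants of the multivariate
  ring.
\<close>

definition q :: "nat \<Rightarrow> mpoly poly" where
  "q k = map_poly Const (p k)"

lemma degree_lift: "degree (q k) = k"
proof -
  have "degree (q k) = degree (p k)"
    unfolding q_def by (rule degree_map_poly) (metis Const_eq_iff Const.hom_zero)
  then show ?thesis by (simp add: degree_p)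
qed

sublocale Q: orthogonal_polys q "extend L" "\<lambda>k. Const (1 / h k)"
proof
  have e: "extend L (q j * q k) = Const (pairing L (p j) (p k))" for j k
    by (simp add: q_def pairing_def linear_L extend_map_poly_Const flip: map_poly_Const_mult)
  show "lead_coeff (q k) = 1" for k
    unfolding degree_lift by (simp add: q_def coeff_map_poly coeff_p)
  show "extend L (q j * q k) = 0" if "j \<noteq> k" for j k
    using that by (simp add: e pairing_p)
  show "extend L (q k * q k) * Const (1 / h k) = 1" for k
    using h_nonzero[of k] unfolding e h_def[symmetric] Const.hom_mult[symmetric] by simp
qed (auto simp: degree_lift extend_add extend_smult)

lemma poly_q: "poly (q k) t = univ_at (p k) t"
  by (simp add: q_def univ_at_def)

lemma integrate_univ_at: "integrate_var L i (univ_at f (X i)) = Const (L f)"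
  unfolding univ_at_def
  by (subst integrate_var_poly) (simp_all add: coeff_map_poly extend_map_poly_Const linear_L)

section \<open>Nonvanishing of an alternant\<close>

text \<open>
  Integrating against \<open>\<Prod>j. p (N + j) (X j)\<close> leaves, by orthogonality, only the diagonal term of
  the determinant, which is a product of nonzero norms. This nonvanishing allows the minor in
  \<open>CD_determinant_identity\<close> to be cancelled.
\<close>

lemma alternant_p_nonzero: "alternant (\<lambda>i. p (N + i)) m X \<noteq> 0"
proof
  let ?S = "{\<sigma>. \<sigma> permutes {..<m}}"
  let ?B = "\<Prod>j<m. univ_at (p (N + j)) (X j)"
  have "alternant (\<lambda>i. p (N + i)) m X * ?B
      = (\<Sum>\<sigma>\<in>?S. of_int (sign \<sigma>) * (\<Prod>j<m. univ_at (p (N + \<sigma> j) * p (N + j)) (X j)))"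
    by (simp add: alternant_def det_mat_columns sum_distrib_right univ_at_mult prod.distrib mult.assoc)
  then have "integrals L [0..<0 + m] (alternant (\<lambda>i. p (N + i)) m X * ?B)
      = (\<Sum>\<sigma>\<in>?S. integrals L [0..<0 + m] (of_int (sign \<sigma>) * (\<Prod>j<m. univ_at (p (N + \<sigma> j) * p (N + j)) (X j))))"
    by (simp only: integrals_sum)
  also have "\<dots> = (\<Sum>\<sigma>\<in>?S. of_int (sign \<sigma>) * (\<Prod>j<m. Const (pairing L (p (N + \<sigma> j)) (p (N + j)))))"
  proof (intro sum.cong refl)
    fix \<sigma> :: "nat \<Rightarrow> nat"
    have "in_vars (- {0..<0 + m}) (of_int (sign \<sigma>) :: mpoly)"
      by (metis Const.hom_of_int in_vars_Const)
    then show "integrals L [0..<0 + m] (of_int (sign \<sigma>) * (\<Prod>j<m. univ_at (p (N + \<sigma> j) * p (N + j)) (X j)))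
        = of_int (sign \<sigma>) * (\<Prod>j<m. Const (pairing L (p (N + \<sigma> j)) (p (N + j))))"
      by (subst integrals_prod_upt) (auto simp: integrate_univ_at pairing_def intro!: in_vars_univ_at in_vars_X)
  qed
  also have "\<dots> = (\<Sum>\<sigma>\<in>{id}. of_int (sign \<sigma>) * (\<Prod>j<m. Const (pairing L (p (N + \<sigma> j)) (p (N + j)))))"
  proof (rule sum.mono_neutral_right)
    show "\<forall>\<sigma>\<in>?S - {id}. of_int (sign \<sigma>) * (\<Prod>j<m. Const (pairing L (p (N + \<sigma> j)) (p (N + j)))) = 0"
    proof
      fix \<sigma> assume s: "\<sigma> \<in> ?S - {id}"
      then obtain j where j: "\<sigma> j \<noteq> j" by (metis DiffE eq_id_iff singletonI)
      then have "j \<in> {..<m}" using s by (auto simp: permutes_def)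
      then show "of_int (sign \<sigma>) * (\<Prod>j<m. Const (pairing L (p (N + \<sigma> j)) (p (N + j)))) = 0"
        using j pairing_p[of "N + \<sigma> j" "N + j"] by (auto intro!: prod_zero bexI[of _ j])
    qed
  qed (auto simp: finite_permutations permutes_id)
  also have "\<dots> = Const (\<Prod>j<m. h (N + j))"
    by (simp add: h_def Const.hom_prod)
  finally have *: "integrals L [0..<0 + m] (alternant (\<lambda>i. p (N + i)) m X * ?B) = Const (\<Prod>j<m. h (N + j))" .
  assume "alternant (\<lambda>i. p (N + i)) m X = 0"
  then show False
    using * h_nonzero by (simp add: Const_eq_0_iff)
qed

section \<open>The reproducing kernel\<close>

text \<open>
  This turns out to be \<open>\<Delta>(x) \<Delta>(y) K\<^sub>m(x, y)\<close>.
\<close>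

definition CD_det :: "nat \<Rightarrow> nat \<Rightarrow> mpoly" where
  "CD_det n m = det (mat m m (\<lambda>(i,j). poly (Q.CD n (X j)) (X (m + i))))"

text \<open>
  The coefficients of the Cauchy--Binet expansion over all maps from \<open>{..<m}\<close> to \<open>{..<n}\<close>.
\<close>

definition weight :: "nat \<Rightarrow> (nat \<Rightarrow> nat) \<Rightarrow> complex" where
  "weight m k = 1 / fact m * (\<Prod>i<m. 1 / h (k i))"

abbreviation F :: "nat \<Rightarrow> nat \<Rightarrow> (nat \<Rightarrow> nat) set" where
  "F n m \<equiv> PiE {..<m} (\<lambda>_. {..<n})"

abbreviation \<Phi> :: "nat \<Rightarrow> (nat \<Rightarrow> nat) \<Rightarrow> mpoly" where
  "\<Phi> m k \<equiv> alternant (\<lambda>i. p (k i)) m X"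

lemma to_y_\<Phi>: "to_y m (\<Phi> m k) = alternant (\<lambda>i. p (k i)) m (\<lambda>i. X (m + i))"
  by (simp add: to_y_def msubst_alternant)

lemma \<Phi>_antisym: "k \<in> F n m \<Longrightarrow> \<Phi> m k \<in> antisym_space n m"
  by (rule alternant_antisym) (auto simp: degree_p)

lemma CD_det_sum: "CD_det n m = (\<Sum>k\<in>F n m. Const (weight m k) * \<Phi> m k * to_y m (\<Phi> m k))"
proof -
  have "of_nat (fact m) * CD_det n m = (\<Sum>k\<in>F n m. Const (\<Prod>i<m. 1 / h (k i)) * \<Phi> m k * to_y m (\<Phi> m k))"
    unfolding CD_det_def Q.det_CD_sum to_y_\<Phi> by (simp add: alternant_def poly_q Const.hom_prod)
  moreover have "CD_det n m = Const (1 / fact m) * (of_nat (fact m) * CD_det n m)"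
  proof -
    have "Const (1 / fact m) * of_nat (fact m) = Const (1 / fact m * of_nat (fact m))"
      by (simp only: Const.hom_mult Const.hom_of_nat)
    then show ?thesis by (simp flip: mult.assoc)
  qed
  ultimately have "CD_det n m = Const (1 / fact m) *
      (\<Sum>k\<in>F n m. Const (\<Prod>i<m. 1 / h (k i)) * \<Phi> m k * to_y m (\<Phi> m k))"
    by (simp only:)
  then show ?thesis
    unfolding weight_def Const.hom_mult sum_distrib_left mult.assoc .
qed

lemma CD_det_tensor: "CD_det n m \<in> antisym_tensor n m"
proof -
  have "finite (F n m)" by (simp add: finite_PiE)
  then obtain e where e: "bij_betw e {0..<card (F n m)} (F n m)"
    using ex_bij_betw_nat_finite by blast
  have "CD_det n m = (\<Sum>i\<in>{0..<card (F n m)}. Const (weight m (e i)) * \<Phi> m (e i) * to_y m (\<Phi> m (e i)))"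
    unfolding CD_det_sum by (rule sum.reindex_bij_betw[OF e, symmetric])
  moreover have "e i \<in> F n m" if "i < card (F n m)" for i
    using that bij_betwE[OF e] by auto
  ultimately show ?thesis
    unfolding antisym_tensor_def lessThan_atLeast0[symmetric]
    by (intro CollectI exI[of _ "card (F n m)"] exI[of _ "\<lambda>i. Const (weight m (e i)) * \<Phi> m (e i)"]
        exI[of _ "\<lambda>i. \<Phi> m (e i)"] conjI allI impI antisym_space_Const_mult \<Phi>_antisym)
qed

lemma in_vars_coeff_CD: "in_vars I t \<Longrightarrow> in_vars I (coeff (Q.CD n t) k)"
  by (auto simp: Q.CD_def coeff_sum poly_q q_def[THEN arg_cong, of "\<lambda>f. coeff f _"] coeff_map_poly
      intro!: in_vars_sum in_vars_mult in_vars_univ_at)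

lemma in_vars_poly: "(\<And>k. in_vars I (coeff f k)) \<Longrightarrow> in_vars I t \<Longrightarrow> in_vars I (poly f t)"
  by (auto simp: poly_altdef intro!: in_vars_sum in_vars_mult in_vars_power)

lemma integrate_monom_CD:
  assumes "a < n" "i \<noteq> j"
  shows "integrate_var L i (X i ^ a * poly (Q.CD n (X j)) (X i)) = X j ^ a"
proof -
  have "X i ^ a * poly (Q.CD n (X j)) (X i) = poly (monom 1 a * Q.CD n (X j)) (X i)"
    by (simp add: poly_monom)
  also have "integrate_var L i \<dots> = extend L (monom 1 a * Q.CD n (X j))"
    using assms by (intro integrate_var_poly) (auto simp: coeff_monom_mult intro!: in_vars_coeff_CD in_vars_X)
  also have "\<dots> = poly (monom 1 a) (X j)"
    using assms(1) by (intro Q.CD_reproducing) auto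
  finally show ?thesis by (simp add: poly_monom)
qed

text \<open>
  For a monomial \<open>f\<close> the integrand is a product of one-variable functions, and each factor is
  reproduced by the one-variable kernel.
\<close>

lemma integrals_CD:
  assumes "box {..<m} n f" "\<sigma> permutes {..<m}"
  shows "integrals L [m..<m + m] (to_y m f * (\<Prod>i<m. poly (Q.CD n (X (\<sigma> i))) (X (m + i))))
    = msubst (\<lambda>i. X (\<sigma> i)) f"
proof -
  have s: "\<sigma> i < m" if "i < m" for i
    using permutes_in_image[OF assms(2), of i] that by simp
  have "integrals L [m..<m + m] (Const (lookup f a) *
        (\<Prod>i<m. X (m + i) ^ lookup a i * poly (Q.CD n (X (\<sigma> i))) (X (m + i))))
      = Const (lookup f a) * (\<Prod>i<m. X (\<sigma> i) ^ lookup a i)" if "a \<in> keys f" for a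
  proof -
    have "lookup a i < n" if "i < m" for i
      using assms(1) \<open>a \<in> keys f\<close> that by (auto simp: box_def)
    then have "(\<Prod>i<m. integrate_var L (m + i) (X (m + i) ^ lookup a i * poly (Q.CD n (X (\<sigma> i))) (X (m + i))))
        = (\<Prod>i<m. X (\<sigma> i) ^ lookup a i)"
      using s by (intro prod.cong refl integrate_monom_CD) force+
    moreover have "in_vars (- ({m..<m + m} - {m + i})) (X (m + i) ^ lookup a i * poly (Q.CD n (X (\<sigma> i))) (X (m + i)))"
      if "i < m" for i
      using s[OF that] by (intro in_vars_mult in_vars_power in_vars_poly in_vars_coeff_CD in_vars_X) auto
    ultimately show ?thesis by (subst integrals_prod_upt) auto
  qed
  then show ?thesis
    unfolding to_y_def msubst_box[OF assms(1)]
    by (simp add: sum_distrib_right integrals_sum mult.assoc flip: prod.distrib)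
qed

text \<open>
  Each of the \<open>m!\<close> terms of the determinant reproduces \<open>f\<close> with its variables permuted, which by
  antisymmetry is \<open>f\<close> up to the sign that the term carries.
\<close>

lemma CD_det_reproduces:
  assumes f: "f \<in> antisym_space n m"
  shows "integrate_vars L m m (to_y m f * CD_det n m) = f"
proof -
  let ?S = "{\<sigma>. \<sigma> permutes {..<m}}"
  have box: "box {..<m} n f" using f by (simp add: antisym_space_iff)
  have "integrals L [m..<m + m] (to_y m f * CD_det n m)
      = (\<Sum>\<sigma>\<in>?S. integrals L [m..<m + m] (of_int (sign \<sigma>) *
          (to_y m f * (\<Prod>i<m. poly (Q.CD n (X (\<sigma> i))) (X (m + i))))))"
    unfolding CD_det_def det_mat_rows by (simp add: sum_distrib_left integrals_sum mult.left_commute)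
  also have "\<dots> = (\<Sum>\<sigma>\<in>?S. of_int (sign \<sigma>) * msubst (\<lambda>i. X (\<sigma> i)) f)"
  proof (intro sum.cong refl)
    fix \<sigma> assume "\<sigma> \<in> ?S"
    moreover have "in_vars (- set [m..<m + m]) (of_int (sign \<sigma>) :: mpoly)"
      by (metis Const.hom_of_int in_vars_Const)
    ultimately show "integrals L [m..<m + m] (of_int (sign \<sigma>) *
        (to_y m f * (\<Prod>i<m. poly (Q.CD n (X (\<sigma> i))) (X (m + i)))))
        = of_int (sign \<sigma>) * msubst (\<lambda>i. X (\<sigma> i)) f"
      using integrals_CD[OF box] by (simp only: integrals_mult_left mem_Collect_eq)
  qed
  also have "\<dots> = (\<Sum>\<sigma>\<in>?S. f)"
    using f by (intro sum.cong refl) (auto simp: antisym_space_iff sign_def)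
  also have "\<dots> = of_nat (fact m) * f"
    by (simp add: card_permutations[of _ m])
  finally have e: "integrals L [m..<m + m] (to_y m f * CD_det n m) = of_nat (fact m) * f" .
  have "integrate_vars L m m (to_y m f * CD_det n m) = Const (1 / fact m * of_nat (fact m)) * f"
    unfolding integrate_vars_def e Const.hom_mult Const.hom_of_nat by (simp only: mult.assoc)
  then show ?thesis by simp
qed

text \<open>
  Write \<open>R = \<Sum>k. f k (x) g k (y)\<close>. Expanding each \<open>g k\<close> by the reproducing property of \<open>CD_det\<close>
  gives \<open>R\<close> as a combination of the \<open>\<Phi> s (y)\<close>. The coefficient of \<open>\<Phi> s (y)\<close> is the weight of
  \<open>s\<close> times the integral of \<open>\<Phi> s\<close> against \<open>R\<close>, and that integral is \<open>\<Phi> s (x)\<close> as \<open>R\<close> reproduces.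
  So \<open>R\<close> equals the Cauchy--Binet expansion of \<open>CD_det\<close>.
\<close>

lemma reproducing_unique:
  assumes "is_reproducing_kernel L n m R"
  shows "R = CD_det n m"
proof -
  have rep: "integrate_vars L m m (to_y m f * R) = f" if "f \<in> antisym_space n m" for f
    using assms that by (simp add: is_reproducing_kernel_def)
  obtain N and f g where R: "R = (\<Sum>k<N. f k * to_y m (g k))"
    and fg: "\<And>k::nat. k < N \<Longrightarrow> f k \<in> antisym_space n m \<and> g k \<in> antisym_space n m"
    using assms by (auto simp: is_reproducing_kernel_def antisym_tensor_def)
  have iv: "in_vars {..<m} u" if "u \<in> antisym_space n m" for u
    using that by (auto simp: antisym_space_iff box_in_vars)
  have x: "in_vars (- {m..<m + m}) u" if "u \<in> antisym_space n m" for u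
    using iv[OF that] by (rule in_vars_mono) auto
  have "\<exists>c. integrate_vars L m m (to_y m u * to_y m v) = Const c"
    if "u \<in> antisym_space n m" "v \<in> antisym_space n m" for u v
    using that by (intro integrate_vars_const in_vars_mult in_vars_to_y iv)
  then obtain c where c: "\<And>u v. u \<in> antisym_space n m \<Longrightarrow> v \<in> antisym_space n m \<Longrightarrow>
      integrate_vars L m m (to_y m u * to_y m v) = Const (c u v)" by metis
  have 1: "\<Phi> m s = (\<Sum>k<N. f k * Const (c (\<Phi> m s) (g k)))" if "s \<in> F n m" for s
  proof -
    have "\<Phi> m s = integrate_vars L m m (\<Sum>k<N. f k * (to_y m (\<Phi> m s) * to_y m (g k)))"
      using rep[OF \<Phi>_antisym[OF that]] by (simp add: R sum_distrib_left mult.left_commute)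
    also have "\<dots> = (\<Sum>k<N. f k * Const (c (\<Phi> m s) (g k)))"
      using fg \<Phi>_antisym[OF that] by (simp add: integrate_vars_sum integrate_vars_mult_left x c)
    finally show ?thesis .
  qed
  have 2: "g k = (\<Sum>s\<in>F n m. Const (weight m s) * \<Phi> m s * Const (c (\<Phi> m s) (g k)))" if "k < N" for k
  proof -
    have g: "g k \<in> antisym_space n m" using fg[OF that] by simp
    have "g k = integrate_vars L m m (\<Sum>s\<in>F n m. Const (weight m s) * \<Phi> m s * (to_y m (\<Phi> m s) * to_y m (g k)))"
      using CD_det_reproduces[OF g] by (simp add: CD_det_sum sum_distrib_left mult_ac)
    also have "\<dots> = (\<Sum>s\<in>F n m. Const (weight m s) * \<Phi> m s * Const (c (\<Phi> m s) (g k)))"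
      unfolding integrate_vars_sum
      by (intro sum.cong refl)
         (simp add: integrate_vars_mult_left in_vars_mult x \<Phi>_antisym c g)
    finally show ?thesis .
  qed
  have "R = (\<Sum>k<N. \<Sum>s\<in>F n m. f k * (Const (weight m s) * to_y m (\<Phi> m s) * Const (c (\<Phi> m s) (g k))))"
    unfolding R
  proof (intro sum.cong refl)
    fix k assume "k \<in> {..<N}"
    then have "to_y m (g k) = to_y m (\<Sum>s\<in>F n m. Const (weight m s) * \<Phi> m s * Const (c (\<Phi> m s) (g k)))"
      using 2[of k] by auto
    also have "\<dots> = (\<Sum>s\<in>F n m. Const (weight m s) * to_y m (\<Phi> m s) * Const (c (\<Phi> m s) (g k)))"
      by (simp add: to_y_def msubst_sum msubst_mult)
    finally show "f k * to_y m (g k)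
        = (\<Sum>s\<in>F n m. f k * (Const (weight m s) * to_y m (\<Phi> m s) * Const (c (\<Phi> m s) (g k))))"
      by (simp add: sum_distrib_left)
  qed
  also have "\<dots> = (\<Sum>s\<in>F n m. Const (weight m s) * (\<Sum>k<N. f k * Const (c (\<Phi> m s) (g k))) * to_y m (\<Phi> m s))"
    by (subst sum.swap) (simp add: sum_distrib_left sum_distrib_right mult_ac)
  also have "\<dots> = CD_det n m"
    unfolding CD_det_sum by (intro sum.cong refl) (simp flip: 1)
  finally show ?thesis .
qed

section \<open>Division by the Vandermonde products\<close>

lemma CD_det_divisible: "\<exists>K. CD_det n m = Delta m X * Delta m (\<lambda>i. X (m + i)) * K"
proof -
  have "\<exists>c. alternant f m t = Delta m t * c" for f t
    using Delta_factor_alternant[of m "\<lambda>i. map_poly Const (f i)" t] by (simp add: alternant_def univ_at_def)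
  then obtain c where c: "\<And>f t. alternant f m t = Delta m t * c f t" by metis
  have "CD_det n m = Delta m X * Delta m (\<lambda>i. X (m + i)) *
      (\<Sum>k\<in>F n m. Const (weight m k) * c (\<lambda>i. p (k i)) X * c (\<lambda>i. p (k i)) (\<lambda>i. X (m + i)))"
    unfolding CD_det_sum to_y_\<Phi> unfolding c by (simp add: sum_distrib_left mult_ac)
  then show ?thesis by blast
qed

lemma Delta_y_nonzero: "Delta m (\<lambda>i. X (m + i)) \<noteq> 0"
  using Delta_X_nonzero[of "m + m"] by (auto simp: Delta_split)

lemma cd_kernel_eq: "CD_det n m = Delta m X * Delta m (\<lambda>i. X (m + i)) * cd_kernel L n m"
proof -
  let ?D = "Delta m X * Delta m (\<lambda>i. X (m + i))"
  obtain K where K: "CD_det n m = ?D * K" using CD_det_divisible by blast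
  have "is_reproducing_kernel L n m (?D * K)"
    unfolding K[symmetric] is_reproducing_kernel_def using CD_det_tensor CD_det_reproduces by auto
  moreover have "K' = K" if "is_reproducing_kernel L n m (?D * K')" for K'
    using reproducing_unique[OF that] K Delta_X_nonzero Delta_y_nonzero by simp
  ultimately have "cd_kernel L n m = K"
    unfolding cd_kernel_def by (rule the_equality)
  then show ?thesis using K by simp
qed

text \<open>
  The nonzero minor of \<open>CD_determinant_identity\<close> cancels, and the product of the differences
  \<open>y i - x j\<close> completes \<open>\<Delta>(x) \<Delta>(y)\<close> to \<open>\<Delta>(z)\<close>.
\<close>

lemma cd_kernel_det:
  assumes "m \<le> n"
  shows "det (mat (2 * m) (2 * m) (\<lambda>(i, j). univ_at (p (n - m + j)) (X i))) * (\<Prod>a<m. Const (1 / h (n - m + a)))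
    = Delta (2 * m) X * cd_kernel L n m"
proof -
  let ?A = "det (mat m m (\<lambda>(i,j). poly (q (n + j)) (X i)))"
  have "?A = det (transpose_mat (mat m m (\<lambda>(i,j). poly (q (n + i)) (X j))))"
    by (intro arg_cong[of _ _ det] eq_matI) auto
  then have "?A = alternant (\<lambda>i. p (n + i)) m X"
    by (simp add: det_transpose[of _ m] alternant_def poly_q)
  then have nz: "?A \<noteq> 0" using alternant_p_nonzero by simp
  have "det (mat (2 * m) (2 * m) (\<lambda>(i, j). univ_at (p (n - m + j)) (X i))) * (\<Prod>a<m. Const (1 / h (n - m + a)))
      = (\<Prod>i<m. \<Prod>j<m. X (m + i) - X j) * CD_det n m"
    using Q.CD_determinant_identity[OF assms, of X] nz unfolding CD_det_def poly_q[symmetric] by simp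
  moreover have "Delta (2 * m) X
      = Delta m X * Delta m (\<lambda>i. X (m + i)) * (\<Prod>i<m. \<Prod>j<m. X (m + i) - X j)"
    unfolding mult_2 by (rule Delta_split)
  ultimately show ?thesis
    unfolding cd_kernel_eq by (simp only: mult_ac)
qed

end

theorem proposition2:
  fixes L :: "complex poly \<Rightarrow> complex" and p :: "nat \<Rightarrow> complex poly" and n m :: nat
  assumes "Vector_Spaces.linear smult (*) L"
    and "\<And>k. k \<ge> 1 \<Longrightarrow> nondegenerate_on L (polys_upto k)"
    and "monic_orthogonal L p"
    and "m \<le> n"
  shows "to_fract (cd_kernel L n m) =
    to_fract (Const (1 / (\<Prod>i=1..m. pairing L (p (n - i)) (p (n - i))))) *
    (to_fract (det (mat (2 * m) (2 * m) (\<lambda>(i, j). univ_at (p (n - m + j)) (X i)))) /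
     to_fract (Delta (2 * m) X))"
proof -
  interpret moment_functional L p
    by (rule moment_functional.intro) (fact assms)+
  let ?W = "det (mat (2 * m) (2 * m) (\<lambda>(i, j). univ_at (p (n - m + j)) (X i)))"
  let ?c = "1 / (\<Prod>i=1..m. pairing L (p (n - i)) (p (n - i)))"
  have "(\<Prod>i=1..m. pairing L (p (n - i)) (p (n - i))) = (\<Prod>a<m. h (n - m + a))"
    unfolding h_def
    by (rule prod.reindex_bij_witness[of _ "\<lambda>a. m - a" "\<lambda>i. m - i"]) (use assms(4) in auto)
  then have "(\<Prod>a<m. Const (1 / h (n - m + a))) = Const ?c"
    by (simp add: prod_dividef flip: Const.hom_prod)
  then have "?W * Const ?c = Delta (2 * m) X * cd_kernel L n m"
    using cd_kernel_det[OF assms(4)] by simp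
  then have "to_fract ?W * to_fract (Const ?c) = to_fract (Delta (2 * m) X) * to_fract (cd_kernel L n m)"
    by (simp flip: to_fract_mult)
  then show ?thesis
    using Delta_X_nonzero[of "2 * m"] by (simp add: field_simps)
qed

end
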